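(* Let $\mathcal X\subset\mathbb R^d$ be a compact convex set, let $L>0$, $\gamma\in(0,1]$, and let $f:\mathbb R^d\to\mathbb R$ be $L$-smooth in $\mathcal X$ and $\gamma$-quasar convex in $\mathcal X$ with center $x^\ast\in\mathcal X$. Let $x_0\in\mathcal X$ and let $D=\operatorname{diam}(\{x\in\mathcal X: f(x)\le f(x_0)\})$. Let $(x_t)_{t\ge0}$ be the iterates of projected gradient descent with step size $\eta=1/L$, i.e. $x_{t+1}=\operatorname{Proj}_{\mathcal X}(x_t-\frac1L\nabla f(x_t))$ for $t\ge0$. Then, for all $t\ge1$, $$f(x_t)-f(x^\ast)\le\frac{20LD^2}{(t+1)\gamma^2}.$$
   Context: A function is differentiable on a closed set $\mathcal X$ if it is differentiable in an open neighborhood of $\mathcal X$. A differentiable $f$ is $L$-smooth in $\mathcal X$ if $\|\nabla f(x)-\nabla f(y)\|_2\le L\|x-y\|_2$ for all $x,y\in\mathcal X$. For $\gamma\in(0,1]$, $f$ is $\gamma$-quasar convex in $\mathcal X$ with center $x^\ast\in\mathcal X$ if $x^\ast\in\arg\min_{x\in\mathcal X}f(x)$ and $f(x^\ast)\ge f(x)+\frac1\gamma\langle\nabla f(x),x^\ast-x\rangle$ for all $x\in\mathcal X$. $\operatorname{Proj}_{\mathcal X}(x)=\arg\min_{y\in\mathcal X}\|y-x\|_2$ is the Euclidean projection, and the diameter is with respect to $\|\cdot\|_2$. *)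

theory Defs
  imports "HOL-Analysis.Analysis"
begin

definition gradient :: "('a::euclidean_space \<Rightarrow> real) \<Rightarrow> 'a \<Rightarrow> 'a" where
  "gradient f x = (THE g. GDERIV f x :> g)"

definition differentiable_near :: "('a::euclidean_space \<Rightarrow> real) \<Rightarrow> 'a set \<Rightarrow> bool" where
  "differentiable_near f X \<longleftrightarrow> (\<exists>U. open U \<and> X \<subseteq> U \<and> (\<forall>x\<in>U. f differentiable (at x)))"

definition smooth_in :: "real \<Rightarrow> ('a::euclidean_space \<Rightarrow> real) \<Rightarrow> 'a set \<Rightarrow> bool" where
  "smooth_in L f X \<longleftrightarrow> differentiable_near f X \<and>
     (\<forall>x\<in>X. \<forall>y\<in>X. norm (gradient f x - gradient f y) \<le> L * norm (x - y))"

text \<open>Differentiability is included because the total function \<^const>\<open>gradient\<close> is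
  meaningless at points where \<open>f\<close> is not differentiable.\<close>

definition quasar_convex_in ::
  "real \<Rightarrow> ('a::euclidean_space \<Rightarrow> real) \<Rightarrow> 'a set \<Rightarrow> 'a \<Rightarrow> bool" where
  "quasar_convex_in \<gamma> f X xs \<longleftrightarrow> differentiable_near f X \<and>
     is_arg_min f (\<lambda>x. x \<in> X) xs \<and>
     (\<forall>x\<in>X. f xs \<ge> f x + (1 / \<gamma>) * (gradient f x \<bullet> (xs - x)))"

end

theory Submission
  imports Defs
begin

text \<open>
  Write \<open>h\<^sub>t = f x\<^sub>t - f x\<^sup>*\<close>. The projected step minimises the quadratic upper model of \<open>f\<close> at
  \<open>x\<^sub>t\<close> over \<open>X\<close>; comparing with the points of the segment from \<open>x\<^sub>t\<close> to \<open>x\<^sup>*\<close> gives, for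
  \<open>0 \<le> a \<le> 1\<close>, the bound \<open>h\<^sub>t\<^sub>+\<^sub>1 \<le> h\<^sub>t + a \<langle>\<nabla>f x\<^sub>t, x\<^sup>* - x\<^sub>t\<rangle> + L a\<^sup>2 D\<^sup>2 / 2\<close>.
  For \<open>a = 1\<close> the lower quadratic bound for \<open>f x\<^sup>*\<close> yields \<open>h\<^sub>t\<^sub>+\<^sub>1 \<le> L D\<^sup>2\<close>, however large \<open>h\<^sub>0\<close> is.
  Hence \<open>a = \<gamma> h\<^sub>t / (L D\<^sup>2)\<close> is admissible for \<open>t \<ge> 1\<close>, and quasar convexity gives
  \<open>h\<^sub>t\<^sub>+\<^sub>1 \<le> h\<^sub>t - \<gamma>\<^sup>2 h\<^sub>t\<^sup>2 / (2 L D\<^sup>2)\<close>, which forces decay of order \<open>1 / t\<close>.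
\<close>

text \<open>The derivative is a linear functional, represented by the vector of its values on the
  basis; its uniqueness makes the description in \<open>gradient\<close> well-defined.\<close>

lemma GDERIV_gradient:
  fixes f :: "'a::euclidean_space \<Rightarrow> real"
  assumes "f differentiable (at x)"
  shows "GDERIV f x :> gradient f x"
proof -
  obtain f' where f': "(f has_derivative f') (at x)"
    using assms by (auto simp: differentiable_def)
  have lin: "linear f'"
    using f' has_derivative_linear by blast
  define g where "g = (\<Sum>b\<in>Basis. f' b *\<^sub>R b)"
  have "f' h = h \<bullet> g" for h
  proof -
    have "f' h = f' (\<Sum>b\<in>Basis. (h \<bullet> b) *\<^sub>R b)"
      by (simp add: euclidean_representation)
    also have "\<dots> = h \<bullet> g"
      by (simp add: g_def linear_sum[OF lin] linear_scale[OF lin] inner_sum_right mult.commute)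
    finally show ?thesis .
  qed
  then have "f' = (\<lambda>h. h \<bullet> g)" by auto
  with f' have g: "GDERIV f x :> g" by (simp add: gderiv_def)
  moreover have "g' = g" if "GDERIV f x :> g'" for g'
  proof -
    have "(\<lambda>h. h \<bullet> g') = (\<lambda>h. h \<bullet> g)"
      using that g unfolding gderiv_def by (rule has_derivative_unique)
    then show ?thesis by (metis vector_eq_ldot)
  qed
  ultimately show ?thesis
    unfolding gradient_def by (rule theI)
qed

text \<open>Along the segment from \<open>x\<close> to \<open>y\<close>, Cauchy-Schwarz and the
  Lipschitz bound make the gap \<phi> nonincreasing, which replaces the usual integral. The gradient
  field \<open>g\<close> is a parameter so that \<open>- f\<close> is covered as well.\<close>

lemma lipschitz_gradient_quadratic_upper_bound:
  fixes f :: "'a::real_inner \<Rightarrow> real"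
  assumes "convex X" "x \<in> X" "y \<in> X"
    and deriv: "\<And>z. z \<in> X \<Longrightarrow> GDERIV f z :> g z"
    and lip: "\<And>z. z \<in> X \<Longrightarrow> norm (g z - g x) \<le> L * norm (z - x)"
  shows "f y \<le> f x + g x \<bullet> (y - x) + L / 2 * (norm (y - x))\<^sup>2"
proof -
  define p where "p s = x + s *\<^sub>R (y - x)" for s :: real
  define \<phi> where
    "\<phi> s = f (p s) - s * (g x \<bullet> (y - x)) - L / 2 * s\<^sup>2 * (norm (y - x))\<^sup>2" for s
  have pX: "p s \<in> X" if "0 \<le> s" "s \<le> 1" for s
    using convexD_alt[OF assms(1-3) that] by (simp add: p_def algebra_simps)
  have "\<phi> 1 \<le> \<phi> 0"
  proof (rule DERIV_nonpos_imp_nonincreasing[where f = \<phi>])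
    fix s :: real assume s: "0 \<le> s" "s \<le> 1"
    have "((\<lambda>s. f (p s)) has_derivative (\<lambda>h. (h *\<^sub>R (y - x)) \<bullet> g (p s))) (at s)"
      using deriv[OF pX[OF s]] unfolding gderiv_def
      by (rule has_derivative_compose[rotated]) (auto simp: p_def intro!: derivative_eq_intros)
    then have fp: "((\<lambda>s. f (p s)) has_real_derivative (y - x) \<bullet> g (p s)) (at s)"
      unfolding has_field_derivative_def
      by (rule has_derivative_eq_rhs) (simp add: fun_eq_iff)
    have "(\<phi> has_real_derivative
        ((y - x) \<bullet> g (p s) - g x \<bullet> (y - x) - L * s * (norm (y - x))\<^sup>2)) (at s)"
      unfolding \<phi>_def by (rule derivative_eq_intros fp refl)+ simp
    moreover have "(y - x) \<bullet> g (p s) - g x \<bullet> (y - x) \<le> L * s * (norm (y - x))\<^sup>2"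
    proof -
      have "(y - x) \<bullet> g (p s) - g x \<bullet> (y - x) = (g (p s) - g x) \<bullet> (y - x)"
        by (simp add: inner_diff_left inner_diff_right inner_commute)
      also have "\<dots> \<le> norm (g (p s) - g x) * norm (y - x)"
        by (rule norm_cauchy_schwarz)
      also have "\<dots> \<le> (L * norm (p s - x)) * norm (y - x)"
        by (intro mult_right_mono lip pX s) simp
      also have "\<dots> = L * s * (norm (y - x))\<^sup>2"
        using s by (simp add: p_def power2_eq_square)
      finally show ?thesis .
    qed
    ultimately show "\<exists>d. (\<phi> has_real_derivative d) (at s) \<and> d \<le> 0"
      by force
  qed simp
  then show ?thesis by (simp add: \<phi>_def p_def)
qed

lemma smooth_in_GDERIV:
  assumes "smooth_in L f X" "z \<in> X"
  shows "GDERIV f z :> gradient f z"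
  using assms by (auto simp: smooth_in_def differentiable_near_def intro: GDERIV_gradient)

lemma smooth_in_upper_bound:
  assumes "smooth_in L f X" "convex X" "x \<in> X" "y \<in> X"
  shows "f y \<le> f x + gradient f x \<bullet> (y - x) + L / 2 * (norm (y - x))\<^sup>2"
  using assms
  by (intro lipschitz_gradient_quadratic_upper_bound[of X] smooth_in_GDERIV)
    (auto simp: smooth_in_def)

lemma smooth_in_lower_bound:
  assumes "smooth_in L f X" "convex X" "x \<in> X" "y \<in> X"
  shows "f x + gradient f x \<bullet> (y - x) - L / 2 * (norm (y - x))\<^sup>2 \<le> f y"
proof -
  have "- f y \<le> - f x + (- gradient f x) \<bullet> (y - x) + L / 2 * (norm (y - x))\<^sup>2"
  proof (rule lipschitz_gradient_quadratic_upper_bound[OF assms(2-4)])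
    fix z assume z: "z \<in> X"
    show "GDERIV (\<lambda>z. - f z) z :> - gradient f z"
      by (intro GDERIV_minus smooth_in_GDERIV[OF assms(1) z])
    show "norm (- gradient f z - - gradient f x) \<le> L * norm (z - x)"
      using assms z by (simp add: smooth_in_def norm_minus_commute[of "gradient f x"])
  qed
  then show ?thesis by simp
qed

text \<open>Completing the square: up to the factor \<open>L / 2\<close> and a constant, the model
  is the squared distance to the unprojected gradient step.\<close>

lemma projected_step_minimizes_quadratic_model:
  fixes x g :: "'a::euclidean_space"
  assumes "closed X" "L > 0" "y \<in> X"
  defines "p \<equiv> closest_point X (x - (1 / L) *\<^sub>R g)"
  shows "g \<bullet> (p - x) + L / 2 * (norm (p - x))\<^sup>2 \<le> g \<bullet> (y - x) + L / 2 * (norm (y - x))\<^sup>2"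
proof -
  have expand: "(dist (x - (1 / L) *\<^sub>R g) w)\<^sup>2
      = (norm (w - x))\<^sup>2 + 2 / L * (g \<bullet> (w - x)) + (norm ((1 / L) *\<^sub>R g))\<^sup>2" for w
  proof -
    have "dist (x - (1 / L) *\<^sub>R g) w = norm ((w - x) + (1 / L) *\<^sub>R g)"
      by (simp add: dist_norm norm_minus_commute algebra_simps)
    then show ?thesis
      by (simp only: dot_norm[symmetric] power2_norm_eq_inner)
        (simp add: inner_add_left inner_add_right inner_commute)
  qed
  have "dist (x - (1 / L) *\<^sub>R g) p \<le> dist (x - (1 / L) *\<^sub>R g) y"
    unfolding p_def using assms by (intro closest_point_le)
  then have "(dist (x - (1 / L) *\<^sub>R g) p)\<^sup>2 \<le> (dist (x - (1 / L) *\<^sub>R g) y)\<^sup>2"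
    by (simp add: power_mono)
  then have "L / 2 * ((norm (p - x))\<^sup>2 + 2 / L * (g \<bullet> (p - x)))
      \<le> L / 2 * ((norm (y - x))\<^sup>2 + 2 / L * (g \<bullet> (y - x)))"
    unfolding expand using \<open>L > 0\<close> by (intro mult_left_mono) auto
  then show ?thesis
    using \<open>L > 0\<close> by (simp add: distrib_left)
qed

lemma projected_step_segment_bound:
  assumes "closed X" "convex X" "L > 0" "smooth_in L f X" "x \<in> X" "y \<in> X"
    and "0 \<le> a" "a \<le> 1"
  shows "f (closest_point X (x - (1 / L) *\<^sub>R gradient f x))
    \<le> f x + a * (gradient f x \<bullet> (y - x)) + L / 2 * a\<^sup>2 * (norm (y - x))\<^sup>2"
proof -
  define p where "p = closest_point X (x - (1 / L) *\<^sub>R gradient f x)"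
  define w where "w = (1 - a) *\<^sub>R x + a *\<^sub>R y"
  have "w \<in> X"
    unfolding w_def using assms by (intro convexD_alt)
  have "p \<in> X"
    unfolding p_def using assms by (intro closest_point_in_set) auto
  then have "f p \<le> f x + gradient f x \<bullet> (p - x) + L / 2 * (norm (p - x))\<^sup>2"
    using assms by (intro smooth_in_upper_bound)
  also have "\<dots> \<le> f x + gradient f x \<bullet> (w - x) + L / 2 * (norm (w - x))\<^sup>2"
    using projected_step_minimizes_quadratic_model[OF assms(1,3) \<open>w \<in> X\<close>, of "gradient f x" x]
    by (simp add: p_def)
  also have "w - x = a *\<^sub>R (y - x)"
    by (simp add: w_def algebra_simps)
  finally show ?thesis
    by (simp add: p_def power_mult_distrib)
qed

text \<open>The map s - s^2 is increasing for s \<le> 1/2, so the bound passes from t to t + 1,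
  because t / (t + 1)^2 \<le> 1 / (t + 2).\<close>

lemma inverse_linear_decay:
  fixes u :: "nat \<Rightarrow> real"
  assumes "u 1 \<le> 1 / 2"
    and step: "\<And>t. t \<ge> 1 \<Longrightarrow> u (Suc t) \<le> u t - (u t)\<^sup>2"
    and "t \<ge> 1"
  shows "u t \<le> 1 / (real t + 1)"
  using \<open>t \<ge> 1\<close>
proof (induction t rule: dec_induct)
  case base
  show ?case using assms by simp
next
  case (step t)
  define v where "v = 1 / (real t + 1)"
  have v: "0 < v" "v \<le> 1 / 2" "u t \<le> v"
    using step by (auto simp: v_def field_simps)
  \<comment> \<open>This product is the difference of \<open>v - v\<^sup>2\<close> and
    \<open>u t - (u t)\<^sup>2\<close>.\<close>
  have "0 \<le> (v - u t) * (1 - v - u t)"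
    using v by (intro mult_nonneg_nonneg) linarith+
  then have "u t - (u t)\<^sup>2 \<le> v - v\<^sup>2"
    by (simp add: algebra_simps power2_eq_square)
  also have "\<dots> \<le> 1 / (real (Suc t) + 1)"
    by (simp add: v_def divide_simps power2_eq_square) (simp add: algebra_simps)
  finally show ?case
    using assms(2) step by fastforce
qed

theorem theorem8:
  fixes X :: "(real ^ 'd) set"
    and f :: "real ^ 'd \<Rightarrow> real"
    and x :: "nat \<Rightarrow> real ^ 'd"
    and xs :: "real ^ 'd"
    and L \<gamma> D :: real
  assumes "compact X" and "convex X"
    and "L > 0" and "0 < \<gamma>" and "\<gamma> \<le> 1"
    and "smooth_in L f X"
    and "xs \<in> X" and "quasar_convex_in \<gamma> f X xs"
    and "x 0 \<in> X"
    and "D = diameter {y \<in> X. f y \<le> f (x 0)}"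
    and "\<And>t. x (Suc t) = closest_point X (x t - (1 / L) *\<^sub>R gradient f (x t))"
  shows "\<forall>t\<ge>1. f (x t) - f xs \<le> 20 * L * D\<^sup>2 / ((real t + 1) * \<gamma>\<^sup>2)"
proof -
  define h where "h t = f (x t) - f xs" for t
  define G where "G t = gradient f (x t) \<bullet> (xs - x t)" for t
  have "closed X" "bounded X"
    using \<open>compact X\<close> by (auto simp: compact_imp_closed compact_imp_bounded)
  have xX: "x t \<in> X" for t
    using assms \<open>closed X\<close> by (cases t) (auto intro!: closest_point_in_set)
  have min: "f xs \<le> f y" if "y \<in> X" for y
    using assms that by (force simp: quasar_convex_in_def is_arg_min_linorder)
  then have h_nonneg: "0 \<le> h t" for t
    using xX by (simp add: h_def)
  have step: "f (x (Suc t)) \<le> f (x t) + a * G t + L / 2 * a\<^sup>2 * (norm (xs - x t))\<^sup>2"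
    if "0 \<le> a" "a \<le> 1" for t a
    unfolding assms G_def using assms that \<open>closed X\<close> xX
    by (intro projected_step_segment_bound)
  \<comment> \<open>Taking \<open>a = 0\<close> shows that the values never increase, so all
    iterates stay, together with \<open>xs\<close>, in the sublevel set of diameter
    \<open>D\<close>.\<close>
  have "f (x t) \<le> f (x 0)" for t
    using step[of 0] by (induction t) (auto intro: order_trans)
  then have dist: "norm (xs - x t) \<le> D" for t
    unfolding assms dist_norm[symmetric] using \<open>bounded X\<close> \<open>xs \<in> X\<close> xX min
    by (intro diameter_bounded_bound) (auto intro: bounded_subset)
  have rec: "h (Suc t) \<le> h t + a * G t + L / 2 * a\<^sup>2 * D\<^sup>2" if "0 \<le> a" "a \<le> 1" for t a
  proof -
    have "L / 2 * a\<^sup>2 * (norm (xs - x t))\<^sup>2 \<le> L / 2 * a\<^sup>2 * D\<^sup>2"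
      using \<open>L > 0\<close> dist by (intro mult_left_mono power_mono) auto
    then show ?thesis
      using step[OF that, of t] by (simp add: h_def)
  qed
  have h_Suc: "h (Suc t) \<le> L * D\<^sup>2" for t
  proof -
    \<comment> \<open>Smoothness alone supplies one half of \<open>L * D\<^sup>2\<close>; the
      quadratic term of the step with \<open>a = 1\<close> supplies the other.\<close>
    have "h t + G t \<le> L / 2 * (norm (xs - x t))\<^sup>2"
      using smooth_in_lower_bound[OF assms(6,2) xX \<open>xs \<in> X\<close>, of t] by (simp add: h_def G_def)
    also have "\<dots> \<le> L / 2 * D\<^sup>2"
      using \<open>L > 0\<close> dist by (intro mult_left_mono power_mono) auto
    finally show ?thesis
      using rec[of 1 t] by simp
  qed
  have quasar: "G t \<le> - \<gamma> * h t" for t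
  proof -
    have "(1 / \<gamma>) * G t \<le> - h t"
      using assms(8) xX[of t] by (fastforce simp: quasar_convex_in_def h_def G_def)
    then show ?thesis
      using \<open>0 < \<gamma>\<close> by (simp add: field_simps)
  qed
  have "h t \<le> 20 * L * D\<^sup>2 / ((real t + 1) * \<gamma>\<^sup>2)" if "t \<ge> 1" for t
  proof (cases "D = 0")
    \<comment> \<open>Here the scaling below would divide by zero, but \<open>h_Suc\<close> already
      gives \<open>h t \<le> 0\<close>.\<close>
    case True
    then show ?thesis
      using h_Suc[of "t - 1"] that by simp
  next
    case False
    define K where "K = L * D\<^sup>2"
    have "K > 0"
      using False \<open>L > 0\<close> by (simp add: K_def)
    \<comment> \<open>This scaling turns the goal into \<open>u t \<le> 1 / (real t + 1)\<close>.
      The constant 20 leaves slack: \<open>u 1 \<le> 1 / 20\<close>, and the recursion has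
      coefficient 10 on the square. With 2 in its place these would become 1/2 and 1, just what
      \<open>inverse_linear_decay\<close> asks for.\<close>
    define u where "u t = h t * \<gamma>\<^sup>2 / (20 * K)" for t
    have "\<gamma>\<^sup>2 \<le> 1"
      using assms(4,5) by (simp add: power_le_one)
    have "u 1 \<le> K * 1 / (20 * K)"
      unfolding u_def using h_Suc[of 0] h_nonneg[of 1] \<open>K > 0\<close> \<open>\<gamma>\<^sup>2 \<le> 1\<close>
      by (intro divide_right_mono mult_mono) (auto simp: K_def)
    then have "u 1 \<le> 1 / 2"
      using \<open>K > 0\<close> by simp
    moreover have "u (Suc t) \<le> u t - (u t)\<^sup>2" if "t \<ge> 1" for t
    proof -
      \<comment> \<open>The minimiser of \<open>- a * \<gamma> * h t + K * a\<^sup>2 / 2\<close>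
        over \<open>a\<close>.\<close>
      define a where "a = \<gamma> * h t / K"
      have "h t \<le> K"
        using h_Suc[of "t - 1"] that by (simp add: K_def)
      then have "\<gamma> * h t \<le> 1 * K"
        using assms(4,5) h_nonneg[of t] by (intro mult_mono) auto
      then have a: "0 \<le> a" "a \<le> 1"
        using h_nonneg[of t] \<open>K > 0\<close> \<open>0 < \<gamma>\<close> by (auto simp: a_def)
      have "h (Suc t) \<le> h t + a * (- \<gamma> * h t) + K * a\<^sup>2 / 2"
        using rec[OF a, of t] mult_left_mono[OF quasar[of t] a(1)] by (simp add: K_def mult_ac)
      also have "\<dots> = h t - \<gamma>\<^sup>2 * (h t)\<^sup>2 / (2 * K)"
        using \<open>K > 0\<close> by (simp add: a_def field_simps power2_eq_square)
      finally have "u (Suc t) \<le> (h t - \<gamma>\<^sup>2 * (h t)\<^sup>2 / (2 * K)) * \<gamma>\<^sup>2 / (20 * K)"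
        unfolding u_def using \<open>K > 0\<close> by (intro divide_right_mono mult_right_mono) auto
      also have "\<dots> = u t - 10 * (u t)\<^sup>2"
        using \<open>K > 0\<close> by (simp add: u_def field_simps power2_eq_square)
      also have "\<dots> \<le> u t - (u t)\<^sup>2"
        by simp
      finally show ?thesis .
    qed
    ultimately have "u t \<le> 1 / (real t + 1)"
      using \<open>t \<ge> 1\<close> by (intro inverse_linear_decay)
    then have "h t * ((real t + 1) * \<gamma>\<^sup>2) \<le> 20 * K"
      using \<open>K > 0\<close> by (simp add: u_def field_simps)
    then show ?thesis
      using \<open>0 < \<gamma>\<close> by (simp add: pos_le_divide_eq K_def)
  qed
  then show ?thesis
    by (simp add: h_def)
qed

end
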